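(* Let $F:V\to\mathbb R$ be convex and continuously differentiable, let $N:V\to V$ be monotone, let $\epsilon>0$, and let $x^\star$ be a fixed solution of $\nabla F(x^\star)+N(x^\star)=0$. Let $$\mathcal E(x,y;\epsilon)=D_F(x,x^\star)+\frac\epsilon2\|y-x^\star\|^2,\qquad \mathcal G(x,y)=\Big(y-x,\ \tfrac1\epsilon\big(\epsilon(x-y)-\nabla F(x)-N(y)\big)\Big),$$ $\mathcal G$ being the vector field of the perturbed VOS flow. Then for all $x,y\in V$ the following perturbed strong Lyapunov property holds: $$-\langle\nabla\mathcal E(x,y;\epsilon),\mathcal G(x,y)\rangle\ \ge\ \mathcal E(x,y;\epsilon)+D_F(x^\star,x)+\frac\epsilon2\|x-y\|^2-\frac\epsilon2\|x-x^\star\|^2 .$$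
   Context: $V$ is a real Hilbert space with inner product $(\cdot,\cdot)$ and norm $\|\cdot\|$, identified with its dual; $\langle\cdot,\cdot\rangle$ denotes the duality pairing (inner product on $V$ or $V\times V$). $N$ is monotone if $(N(x)-N(y),x-y)\ge0$ for all $x,y$. The Bregman divergence is $D_F(y,x)=F(y)-F(x)-\langle\nabla F(x),y-x\rangle$. The gradient is taken with respect to $(x,y)$: $\nabla\mathcal E(x,y;\epsilon)=(\nabla F(x)-\nabla F(x^\star),\ \epsilon(y-x^\star))$. *)

theory Defs
  imports "HOL-Analysis.Analysis"
begin

(* Gradient with respect to the inner product of the space; meaningful only at points where
   the gradient exists. On a product space it is taken with respect to the product inner
   product, so the gradient of a function of (x, y) is a pair. *)
definition grad :: "('a::real_inner \<Rightarrow> real) \<Rightarrow> 'a \<Rightarrow> 'a" where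
  "grad F x = (THE D. GDERIV F x :> D)"

(* Continuity of the Frechet derivative is with respect to the operator norm. *)
definition continuously_differentiable :: "('a::real_normed_vector \<Rightarrow> real) \<Rightarrow> bool" where
  "continuously_differentiable F \<longleftrightarrow>
     (\<exists>F' :: 'a \<Rightarrow> 'a \<Rightarrow>\<^sub>L real.
        (\<forall>x. (F has_derivative blinfun_apply (F' x)) (at x)) \<and> continuous_on UNIV F')"

definition monotone_operator :: "('a::real_inner \<Rightarrow> 'a) \<Rightarrow> bool" where
  "monotone_operator N \<longleftrightarrow> (\<forall>x y. (N x - N y) \<bullet> (x - y) \<ge> 0)"

definition bregman :: "('a::real_inner \<Rightarrow> real) \<Rightarrow> 'a \<Rightarrow> 'a \<Rightarrow> real" where
  "bregman F y x = F y - F x - grad F x \<bullet> (y - x)"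

definition lyapunov ::
  "('a::real_inner \<Rightarrow> real) \<Rightarrow> 'a \<Rightarrow> real \<Rightarrow> 'a \<times> 'a \<Rightarrow> real" where
  "lyapunov F xstar \<epsilon> = (\<lambda>(x, y). bregman F x xstar + \<epsilon> / 2 * (norm (y - xstar))\<^sup>2)"

definition vos_field ::
  "('a::real_inner \<Rightarrow> real) \<Rightarrow> ('a \<Rightarrow> 'a) \<Rightarrow> real \<Rightarrow> 'a \<times> 'a \<Rightarrow> 'a \<times> 'a" where
  "vos_field F N \<epsilon> =
     (\<lambda>(x, y). (y - x, (1 / \<epsilon>) *\<^sub>R (\<epsilon> *\<^sub>R (x - y) - grad F x - N y)))"

end

theory Submission
  imports Defs
begin

text \<open>
  The inequality is an algebraic identity plus one use of monotonicity. Write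
  \<open>g\<close> and \<open>g*\<close> for the gradients of \<open>F\<close> at \<open>x\<close> and \<open>x*\<close>. In the pairing of the
  gradient of the Lyapunov function with the flow, the factor \<open>1/\<epsilon>\<close> cancels
  and, because \<open>N x* = - g*\<close>, the negated pairing becomes
  \<open>(g - g*, x - x*) + \<epsilon> (y - x*, y - x) + (N y - N x*, y - x*)\<close>.
  The last term is nonnegative by monotonicity; the first is the symmetrised Bregman divergence
  \<open>D(x, x*) + D(x*, x)\<close>; and polarisation expresses the middle one through
  the squared lengths of the sides of the triangle \<open>x, y, x*\<close>.

  The analytic content is that the gradient of the Lyapunov function is the expected pair. As
  the gradient is a description that is meaningful only where a gradient exists, \<open>F\<close> must
  be shown to have one: its Frechet derivative is a bounded functional, and completeness of the
  space represents it by a vector (\<open>riesz_representation\<close>).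
\<close>

text \<open>
  The representing vector is the minimiser of the energy \<open>\<parallel>x\<parallel>\<^sup>2 / 2 - f x\<close>.
  The parallelogram law makes every minimising sequence Cauchy, and the vanishing of the first
  variation at the minimiser says that it represents \<open>f\<close>.
\<close>

lemma riesz_representation:
  fixes f :: "'v::{real_inner, complete_space} \<Rightarrow> real"
  assumes "bounded_linear f"
  shows "\<exists>u. \<forall>h. f h = u \<bullet> h"
proof -
  interpret f: bounded_linear f by fact
  define J where "J x = (norm x)\<^sup>2 / 2 - f x" for x
  obtain K where K: "\<And>x. norm (f x) \<le> norm x * K"
    using f.bounded by blast
  have lower: "- K\<^sup>2 / 2 \<le> J x" for x
  proof -
    have "f x \<le> norm x * K" using K[of x] by simp
    moreover have "0 \<le> (norm x - K)\<^sup>2" by simp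
    ultimately show ?thesis
      unfolding J_def power2_diff by (simp add: field_simps)
  qed
  define m where "m = Inf (range J)"
  have bdd: "bdd_below (range J)"
    using lower by (intro bdd_belowI2[where m = "- K\<^sup>2 / 2"]) auto
  have m_le: "m \<le> J x" for x
    unfolding m_def by (rule cInf_lower[OF _ bdd]) auto
  have "\<exists>x. J x < m + inverse (real (Suc n))" for n
    using cInf_lessD[of "range J" "m + inverse (real (Suc n))"]
    by (auto simp: m_def)
  then obtain X where X: "\<And>n. J (X n) < m + inverse (real (Suc n))"
    by metis
  have parallelogram: "(norm (x - y))\<^sup>2 / 4 = J x + J y - 2 * J ((1/2) *\<^sub>R (x + y))" for x y
    unfolding J_def f.scaleR f.add
    by (simp add: power2_norm_eq_inner inner_commute algebra_simps
        add_divide_distrib diff_divide_distrib)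
  have close: "(norm (x - y))\<^sup>2 \<le> 4 * ((J x - m) + (J y - m))" for x y
    using parallelogram[of x y] m_le[of "(1/2) *\<^sub>R (x + y)"] by simp
  have "Cauchy X"
  proof (rule metric_CauchyI)
    fix e :: real
    assume "0 < e"
    then have "0 < e\<^sup>2 / 8" by simp
    then obtain M where M: "inverse (real (Suc M)) < e\<^sup>2 / 8"
      using reals_Archimedean by blast
    have near: "J (X n) - m < e\<^sup>2 / 8" if "M \<le> n" for n
    proof -
      have "inverse (real (Suc n)) \<le> inverse (real (Suc M))"
        using that by (simp add: field_simps)
      with X[of n] M show ?thesis by linarith
    qed
    show "\<exists>M. \<forall>k\<ge>M. \<forall>n\<ge>M. dist (X k) (X n) < e"
    proof (intro exI allI impI)
      fix k n
      assume "M \<le> k" "M \<le> n"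
      then have "J (X k) - m < e\<^sup>2 / 8" "J (X n) - m < e\<^sup>2 / 8"
        by (blast intro: near)+
      then have "(norm (X k - X n))\<^sup>2 < e\<^sup>2"
        using close[of "X k" "X n"] by argo
      then show "dist (X k) (X n) < e"
        using \<open>0 < e\<close> by (simp add: dist_norm power2_less_imp_less)
    qed
  qed
  then obtain u where u: "X \<longlonglongrightarrow> u"
    using Cauchy_convergent convergent_def by blast
  have "(\<lambda>n. J (X n)) \<longlonglongrightarrow> J u"
    unfolding J_def by (intro tendsto_intros f.tendsto u) simp
  moreover have "(\<lambda>n. m + inverse (real (Suc n))) \<longlonglongrightarrow> m + 0"
    by (intro tendsto_intros LIMSEQ_inverse_real_of_nat)
  ultimately have "J u \<le> m + 0"
    by (rule LIMSEQ_le) (blast intro: less_imp_le X)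
  then have minimal: "J u \<le> J x" for x
    using m_le[of x] by simp
  have "f h = u \<bullet> h" for h
  proof (cases "h = 0")
    case False
    define c where "c = u \<bullet> h - f h"
    define s where "s = (norm h)\<^sup>2"
    have "0 < s" using False by (simp add: s_def)
    have variation: "J (u + t *\<^sub>R h) = J u + t * c + t\<^sup>2 * s / 2" for t
      unfolding J_def f.scaleR f.add c_def s_def
      by (simp add: power2_norm_eq_inner inner_commute power2_eq_square[of t] field_simps inner_simps)
    \<comment> \<open>The vertex of this quadratic in \<open>t\<close> lies at \<open>- c / s\<close>.\<close>
    have "0 \<le> (- c / s) * c + (- c / s)\<^sup>2 * s / 2"
      using minimal[of "u + (- c / s) *\<^sub>R h"] variation[of "- c / s"] by linarith
    also have "\<dots> = - (c\<^sup>2 / (2 * s))"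
      using \<open>0 < s\<close> by (simp add: field_simps power2_eq_square)
    finally have "c\<^sup>2 \<le> 0"
      using \<open>0 < s\<close> by (simp add: field_simps)
    then show ?thesis by (simp add: c_def)
  qed (simp add: f.zero)
  then show ?thesis by blast
qed

lemma grad_eqI:
  assumes "GDERIV F x :> D"
  shows "grad F x = D"
  unfolding grad_def
proof (rule the_equality)
  fix E
  assume "GDERIV F x :> E"
  then have "(\<lambda>h. h \<bullet> E) = (\<lambda>h. h \<bullet> D)"
    using assms unfolding gderiv_def by (rule has_derivative_unique)
  then show "E = D"
    by (metis inner_commute vector_eq_rdot)
qed (rule assms)

lemma continuously_differentiable_GDERIV_grad:
  fixes F :: "'v::{real_inner, complete_space} \<Rightarrow> real"
  assumes "continuously_differentiable F"
  shows "GDERIV F x :> grad F x"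
proof -
  obtain L where L: "(F has_derivative L) (at x)"
    using assms unfolding continuously_differentiable_def by blast
  then obtain u where "\<And>h. L h = u \<bullet> h"
    using riesz_representation has_derivative_bounded_linear by metis
  then have "L = (\<lambda>h. h \<bullet> u)"
    by (auto simp: inner_commute)
  with L have "GDERIV F x :> u"
    by (simp add: gderiv_def)
  then show ?thesis
    using grad_eqI by metis
qed

lemma grad_lyapunov:
  assumes "GDERIV F x :> grad F x"
  shows "grad (lyapunov F xstar \<epsilon>) (x, y) = (grad F x - grad F xstar, \<epsilon> *\<^sub>R (y - xstar))"
proof (rule grad_eqI)
  have energy: "lyapunov F xstar \<epsilon> = (\<lambda>p. F (fst p) - F xstar
      - grad F xstar \<bullet> (fst p - xstar) + \<epsilon> / 2 * ((snd p - xstar) \<bullet> (snd p - xstar)))"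
    by (auto simp: lyapunov_def bregman_def power2_norm_eq_inner)
  have "(F has_derivative (\<lambda>h. h \<bullet> grad F x)) (at (fst (x, y)))"
    using assms by (simp add: gderiv_def)
  then have "((\<lambda>p. F (fst p)) has_derivative (\<lambda>h. fst h \<bullet> grad F x)) (at (x, y))"
    by (rule has_derivative_compose[OF has_derivative_fst[OF has_derivative_ident]])
  then show "GDERIV (lyapunov F xstar \<epsilon>) (x, y) :>
      (grad F x - grad F xstar, \<epsilon> *\<^sub>R (y - xstar))"
    unfolding energy gderiv_def
    by (auto intro!: derivative_eq_intros
        simp: fun_eq_iff inner_Pair inner_commute algebra_simps inner_prod_def)
qed

lemma bregman_symmetrised:
  "bregman F x z + bregman F z x = (grad F x - grad F z) \<bullet> (x - z)"
  by (simp add: bregman_def inner_simps)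

theorem lemma8p2:
  fixes F :: "'v::{real_inner, complete_space} \<Rightarrow> real"
    and N :: "'v \<Rightarrow> 'v"
    and \<epsilon> :: real
    and xstar :: 'v
  assumes "convex_on UNIV F"
    and "continuously_differentiable F"
    and "monotone_operator N"
    and "\<epsilon> > 0"
    and "grad F xstar + N xstar = 0"
  shows "\<forall>x y. - (grad (lyapunov F xstar \<epsilon>) (x, y) \<bullet> vos_field F N \<epsilon> (x, y)) \<ge>
           lyapunov F xstar \<epsilon> (x, y) + bregman F xstar x
             + \<epsilon> / 2 * (norm (x - y))\<^sup>2 - \<epsilon> / 2 * (norm (x - xstar))\<^sup>2"
proof (intro allI)
  fix x y
  define g where "g = grad F x"
  define gs where "gs = grad F xstar"
  have N_xstar: "N xstar = - gs"
    using assms(5) by (simp add: gs_def add_eq_0_iff)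
  have "- (grad (lyapunov F xstar \<epsilon>) (x, y) \<bullet> vos_field F N \<epsilon> (x, y))
      = - ((g - gs) \<bullet> (y - x)) - (y - xstar) \<bullet> (\<epsilon> *\<^sub>R (x - y) - g - N y)"
    using \<open>\<epsilon> > 0\<close>
    by (simp add: grad_lyapunov[OF continuously_differentiable_GDERIV_grad[OF assms(2)]]
        vos_field_def g_def gs_def)
  also have "\<dots> = (g - gs) \<bullet> (x - xstar) + \<epsilon> * ((y - xstar) \<bullet> (y - x))
      + (N y - N xstar) \<bullet> (y - xstar)"
    by (simp add: N_xstar inner_commute algebra_simps)
  finally have pairing: "- (grad (lyapunov F xstar \<epsilon>) (x, y) \<bullet> vos_field F N \<epsilon> (x, y))
      = (g - gs) \<bullet> (x - xstar) + \<epsilon> * ((y - xstar) \<bullet> (y - x))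
        + (N y - N xstar) \<bullet> (y - xstar)" .
  have "0 \<le> (N y - N xstar) \<bullet> (y - xstar)"
    using assms(3) by (simp add: monotone_operator_def)
  moreover have "(g - gs) \<bullet> (x - xstar) = bregman F x xstar + bregman F xstar x"
    by (simp add: bregman_symmetrised g_def gs_def)
  moreover have "\<epsilon> * ((y - xstar) \<bullet> (y - x)) = \<epsilon> / 2 * (norm (y - xstar))\<^sup>2
      + \<epsilon> / 2 * (norm (x - y))\<^sup>2 - \<epsilon> / 2 * (norm (x - xstar))\<^sup>2"
    by (simp add: power2_norm_eq_inner inner_commute field_simps inner_simps)
  ultimately show "- (grad (lyapunov F xstar \<epsilon>) (x, y) \<bullet> vos_field F N \<epsilon> (x, y)) \<ge>
      lyapunov F xstar \<epsilon> (x, y) + bregman F xstar x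
        + \<epsilon> / 2 * (norm (x - y))\<^sup>2 - \<epsilon> / 2 * (norm (x - xstar))\<^sup>2"
    unfolding pairing by (simp add: lyapunov_def)
qed

end
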